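(* The GPR cut-cell scheme (the fully discrete scheme described in the context, for two-dimensional two-material compressible Euler flows with stiffened equation of state) is pressure-equilibrium-preserving and geometric-perturbation-robust (GPR).
   Context: Equations. Two-dimensional compressible Euler equations $\partial_t\mathbf U+\nabla\cdot\mathbf F(\mathbf U)=0$ with two materials: $\mathbf U=(\rho,\rho\mathbf v^\top,E)^\top$, $\mathbf F(\mathbf U)=(\rho\mathbf v,\ \rho\mathbf v\otimes\mathbf v+p\mathbf I,\ (E+p)\mathbf v)^\top$, $E=\rho e+\frac12\rho|\mathbf v|^2$, $p=(\gamma-1)\rho e-\gamma B$, with $\gamma>1$, $B\ge0$ constant in each material. Equilibrium set: $\mathcal G(\mathbf v^*,p^*;\gamma,B)=\{(\rho,(\rho\mathbf v^* )^\top,\frac{p^*+\gamma B}{\gamma-1}+\frac12\rho|\mathbf v^*|^2)^\top:\rho>0\}$. Mesh. The numerical interface $\Gamma_h$ is the (piecewise linear) zero contour of a level set function $\phi$ solving $\phi_t+\mathbf v\cdot\nabla\phi=0$. It cuts the cells of a uniform Cartesian grid into polygonal single-material cut cells; undersized cut cells are merged with a neighbour of the same material. The control volumes are the merged cells $\tilde I$ and the fixed Cartesian cells (treated identically, as cells without interface edges). The boundary of $\tilde I$ consists of Cartesian-edge segments $e_{C,1},\dots,e_{C,N_C}$ (fixed or moving strictly tangentially) and interface-edge segments $e_{I,1},\dots,e_{I,N_I}$ (moving with the interface). $(\gamma_h,B_h)$ are the numerical equation-of-state parameters of the cell. Each cell carries $\mathbf U_h^{\mathrm{tot}}$, the numerical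 value of $\int\mathbf U\,\mathrm dx\,\mathrm dy$, and evolved geometric moments $\mathcal M_{s,r}^{\mathrm{evo}}$. The reconstructed moments $\mathcal M_{s,r}^{\mathrm{rec}}$ of a cell are the integrals of $x^sy^r$ computed directly from the cell's polygonal geometry. Quadrature. Two Gauss points $\mathbf x_{C,\alpha}^{(k)}$, resp. $\mathbf x_{I,\beta}^{(\ell)}=(x_{I,\beta}^{(\ell)},y_{I,\beta}^{(\ell)})$, are placed on each segment; $\omega(\cdot)$ is the Gaussian weight (normalized so that weights on a segment sum to 1), $|e(\mathbf x)|$ the length of the segment containing $\mathbf x$, $\mathbf n$ the outward unit normal. Reconstruction. A reconstruction from $\mathbf U_h^{\mathrm{tot}}$ and $\mathcal M_{s,r}^{\mathrm{evo}}$ of neighbouring cells (of the same material) gives at each Gauss point interior and exterior values $\mathbf U^{\mathrm{int}},\mathbf U^{\mathrm{ext}}$. It is equilibrium-compatible (EC): whenever all cell averages $\mathbf U^{\mathrm{tot}}/\mathcal M_{0,0}$ in the stencil share a uniform velocity $\mathbf v^*$ and pressure $p^*$, the reconstructed point values reproduce exactly $\mathbf v^*$ and $p^*$. Fluxes. On Cartesian edges, $\widehat{\mathbf F}^{\mathrm{single}}(\mathbf U^{\mathrm{int}},\mathbf U^{\mathrm{ext}})=\frac12[\mathbf F(\mathbf U^{\mathrm{int}})\cdot\mathbf n+\mathbf F(\mathbf U^{\mathrm{ext}})\cdot\mathbf n-a_{\max}(\mathbf U^{\mathrm{ext}}-\mathbf U^{\mathrm{int}})]$, $a_{\max}$ the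 local maximum spectral radius of $\partial(\mathbf F\cdot\mathbf n)/\partial\mathbf U$. On interface edges, $\widehat{\mathbf F}^{\mathrm{multi}}=(0,p\,\mathbf n^\top,p\,v_\perp)^\top$, with $(p,v_\perp)$ the pressure and normal velocity from a multi-material Riemann solver applied to $(\mathbf U^{\mathrm{int}},\mathbf U^{\mathrm{ext}})$, which returns $(p^*,v_\perp^* )$ if both states share pressure $p^*$ and normal velocity $v_\perp^*$. Operators. $$\mathcal L(\mathcal M_{s,r}^{\mathrm{evo}})=\sum_{\beta=1}^{N_I}\sum_{\ell=1}^2(x_{I,\beta}^{(\ell)})^s(y_{I,\beta}^{(\ell)})^r|e(\mathbf x_{I,\beta}^{(\ell)})|\,\omega(\mathbf x_{I,\beta}^{(\ell)})\,v_\perp(\mathbf x_{I,\beta}^{(\ell)}),$$ $$\mathcal L(\mathbf U_h^{\mathrm{tot}})=-\sum_{\alpha=1}^{N_C}\sum_{k=1}^2|e(\mathbf x_{C,\alpha}^{(k)})|\omega(\mathbf x_{C,\alpha}^{(k)})\widehat{\mathbf F}^{\mathrm{single}}(\mathbf U^{\mathrm{int}}_{C,\alpha,k},\mathbf U^{\mathrm{ext}}_{C,\alpha,k})-\sum_{\beta=1}^{N_I}\sum_{\ell=1}^2|e(\mathbf x_{I,\beta}^{(\ell)})|\omega(\mathbf x_{I,\beta}^{(\ell)})\widehat{\mathbf F}^{\mathrm{multi}}(\mathbf U^{\mathrm{int}}_{I,\beta,\ell},\mathbf U^{\mathrm{ext}}_{I,\beta,\ell}).$$ The GPR cut-cell scheme.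 Step 1: at $t=0$, use $\phi$ to partition all Cartesian cells intersected by the interface into cut cells, and compute $\mathcal M^{\mathrm{rec}}_{s,r}$ for each cut cell. Step 2: apply cell merging; $\mathbf U_h^{\mathrm{tot}}$ and $\mathcal M^{\mathrm{rec}}_{s,r}$ of a merged cell are the sums of those of its subcells; initialize $\mathcal M^{\mathrm{evo}}_{s,r}$ as $\mathcal M^{\mathrm{rec}}_{s,r}$. Step 3: advance $w=\mathbf U_h^{\mathrm{tot}}$ and $w=\mathcal M_{s,r}^{\mathrm{evo}}$ from $t^n$ to $t^{n+1}$ by $w^{(1)}=w^n+\Delta t\mathcal L(w^n)$, $w^{(2)}=\frac34w^n+\frac14(w^{(1)}+\Delta t\mathcal L(w^{(1)}))$, $w^{n+1}=\frac13w^n+\frac23(w^{(2)}+\Delta t\mathcal L(w^{(2)}))$; simultaneously update the interface by solving the level set equation. Step 4: at $t^{n+1}$ repartition the Cartesian cells intersected by the updated interface into cut cells and recompute $\mathcal M^{\mathrm{rec}}_{s,r}$ for each new cut cell. Step 5 (redistribution): for each merged cell $\tilde I$ an EC polynomial reconstruction from neighbouring $\mathbf U_h^{\mathrm{tot}}$ and $\mathcal M^{\mathrm{evo}}_{s,r}$ gives $\mathbf p(x,y)=\sum_{s+r\le N_p}\mathbf a_{s,r}x^sy^r$, $\mathbf a_{s,r}\in\mathbb R^4$, with $\sum_{s+r\le N_p}\mathbf a_{s,r}\mathcal M^{\mathrm{evo}}_{s,r}(\tilde I)=\mathbf U_h^{\mathrm{tot}}(\tilde I)$; each subcell $I$ of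 $\tilde I$ is assigned $\mathbf U_h^{\mathrm{tot}}(I)=\sum_{s+r\le N_p}\mathbf a_{s,r}\mathcal M^{\mathrm{rec}}_{s,r}(I)$ (its cell average being $\mathbf U_h^{\mathrm{tot}}(I)/\mathcal M_{0,0}^{\mathrm{rec}}(I)$). Return to Step 2. Pressure-equilibrium-preserving. A scheme with discrete solution (cell averages) $\mathbf U_h$ and numerical equation-of-state parameters $(\gamma_h,B_h)$ is pressure-equilibrium-preserving if, whenever $\mathbf U_h(\mathbf x,0)\in\mathcal G(\mathbf v^*,p^*;\gamma_h,B_h)$ for all $\mathbf x$, then for any $t>0$, $\mathbf U_h(\mathbf x,t)\in\mathcal G(\mathbf v^*,p^*;\gamma_h,B_h)$ for all $\mathbf x$. GPR. A scheme that captures a discrete interface $\Gamma_h$ is GPR if, whenever it is pressure-equilibrium-preserving for the captured interface $\Gamma_h$, there exists a constant $\varepsilon>0$ such that it remains pressure-equilibrium-preserving for any perturbed interface $\tilde\Gamma_h$ with $d_H(\Gamma_h,\tilde\Gamma_h)<\varepsilon$, $d_H$ the Hausdorff distance.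
   Formalization: The formal theorem assumes that all cell averages, and all reconstructed values at which fluxes are evaluated, have positive density during the computation; without this (no CFL condition is stated) large time steps can make densities negative, so that the solution leaves the equilibrium set. *)

theory Defs
  imports "HOL-Analysis.Analysis" "HOL-Library.Disjoint_Sets"
begin

section \<open>The compressible Euler equations with stiffened equation of state\<close>

type_synonym point = "real^2"

text \<open>A state is the vector \<open>(\<rho>, \<rho> v\<^sub>1, \<rho> v\<^sub>2, E)\<close> of conserved variables.\<close>
type_synonym state = "real^4"

definition density :: "state \<Rightarrow> real" where
  "density U = U $ 1"

definition momentum :: "state \<Rightarrow> real^2" where
  "momentum U = vector [U $ 2, U $ 3]"

definition energy :: "state \<Rightarrow> real" where
  "energy U = U $ 4"

definition velocity :: "state \<Rightarrow> real^2" where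
  "velocity U = momentum U /\<^sub>R density U"

text \<open>\<open>p = (\<gamma> - 1) \<rho> e - \<gamma> B\<close> with \<open>\<rho> e = E - \<rho> |v|\<^sup>2 / 2\<close>.\<close>
definition pressure :: "real \<Rightarrow> real \<Rightarrow> state \<Rightarrow> real" where
  "pressure g B U = (g - 1) * (energy U - 1/2 * density U * (norm (velocity U))\<^sup>2) - g * B"

text \<open>The \<open>4 \<times> 2\<close> flux matrix; \<open>euler_flux g B U *v n\<close> is \<open>F(U) \<cdot> n\<close>.\<close>
definition euler_flux :: "real \<Rightarrow> real \<Rightarrow> state \<Rightarrow> real^2^4" where
  "euler_flux g B U =
     (let \<rho> = density U; v = velocity U; p = pressure g B U in
      vector [\<rho> *\<^sub>R v,
              (\<rho> * v $ 1) *\<^sub>R v + p *\<^sub>R axis 1 1,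
              (\<rho> * v $ 2) *\<^sub>R v + p *\<^sub>R axis 2 1,
              (energy U + p) *\<^sub>R v])"

definition equilibrium_set :: "real^2 \<Rightarrow> real \<Rightarrow> real \<Rightarrow> real \<Rightarrow> state set" where
  "equilibrium_set v p g B =
     {vector [\<rho>, \<rho> * v $ 1, \<rho> * v $ 2, (p + g * B) / (g - 1) + 1/2 * \<rho> * (norm v)\<^sup>2] |
        \<rho>. \<rho> > 0}"

text \<open>The state \<open>U\<close> carries velocity \<open>v\<close> and pressure \<open>p\<close>.  The relations are not divided by
  the density, so they also make sense for a reconstructed value whose density vanishes or is
  negative; for nonzero density they say \<open>velocity U = v\<close> and \<open>pressure g B U = p\<close>.\<close>
definition has_velocity_pressure :: "real^2 \<Rightarrow> real \<Rightarrow> real \<Rightarrow> real \<Rightarrow> state \<Rightarrow> bool" where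
  "has_velocity_pressure v p g B U \<longleftrightarrow>
     momentum U = density U *\<^sub>R v \<and>
     (g - 1) * (energy U - 1/2 * density U * (norm v)\<^sup>2) - g * B = p"

lemma has_velocity_pressure_iff:
  assumes "density U \<noteq> 0"
  shows "has_velocity_pressure v p g B U \<longleftrightarrow> velocity U = v \<and> pressure g B U = p"
  using assms by (auto simp: has_velocity_pressure_def velocity_def pressure_def)

lemma vector_4:
  "(vector [a, b, c, d] :: 'a::zero^4) $ 1 = a"
  "(vector [a, b, c, d] :: 'a::zero^4) $ 2 = b"
  "(vector [a, b, c, d] :: 'a::zero^4) $ 3 = c"
  "(vector [a, b, c, d] :: 'a::zero^4) $ 4 = d"
  unfolding vector_def by simp_all

lemma equilibrium_set_iff:
  assumes "g > 1"
  shows "U \<in> equilibrium_set v p g B \<longleftrightarrow>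
           density U > 0 \<and> velocity U = v \<and> pressure g B U = p"
proof
  assume "U \<in> equilibrium_set v p g B"
  then obtain r where r: "r > 0" and U: "U = vector [r, r * v $ 1, r * v $ 2,
      (p + g * B) / (g - 1) + 1/2 * r * (norm v)\<^sup>2]"
    by (auto simp: equilibrium_set_def)
  have d: "density U = r" "energy U = (p + g * B) / (g - 1) + 1/2 * r * (norm v)\<^sup>2"
    by (simp_all add: U density_def energy_def vector_4)
  have m: "momentum U = r *\<^sub>R v"
    by (simp add: U momentum_def vec_eq_iff forall_2 vector_4)
  have "has_velocity_pressure v p g B U"
    using assms by (simp add: has_velocity_pressure_def d m)
  then show "density U > 0 \<and> velocity U = v \<and> pressure g B U = p"
    using has_velocity_pressure_iff[of U v p g B] d r by auto
next
  assume *: "density U > 0 \<and> velocity U = v \<and> pressure g B U = p"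
  then have h: "has_velocity_pressure v p g B U"
    using has_velocity_pressure_iff[of U v p g B] by auto
  have "momentum U $ 1 = density U * v $ 1" "momentum U $ 2 = density U * v $ 2"
    using h by (auto simp: has_velocity_pressure_def)
  then have "U $ 2 = density U * v $ 1" "U $ 3 = density U * v $ 2"
    by (simp_all add: momentum_def)
  moreover have "energy U = (p + g * B) / (g - 1) + 1/2 * density U * (norm v)\<^sup>2"
    using h assms by (simp add: has_velocity_pressure_def field_simps)
  ultimately have "U = vector [density U, density U * v $ 1, density U * v $ 2,
      (p + g * B) / (g - 1) + 1/2 * density U * (norm v)\<^sup>2]"
    by (simp add: vec_eq_iff forall_4 vector_4 density_def energy_def)
  then show "U \<in> equilibrium_set v p g B"
    using * unfolding equilibrium_set_def by blast
qed

section \<open>Numerical fluxes\<close>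

definition spectral_radius :: "real^'n^'n \<Rightarrow> real" where
  "spectral_radius A =
     Sup {cmod c | c. \<exists>z::complex^'n. z \<noteq> 0 \<and>
            (\<chi> i j. complex_of_real (A $ i $ j)) *v z = c *s z}"

definition wave_speed :: "real \<Rightarrow> real \<Rightarrow> real^2 \<Rightarrow> state \<Rightarrow> real" where
  "wave_speed g B n U = spectral_radius (jacobian (\<lambda>W. euler_flux g B W *v n) (at U))"

definition single_flux :: "real \<Rightarrow> real \<Rightarrow> real^2 \<Rightarrow> state \<Rightarrow> state \<Rightarrow> state" where
  "single_flux g B n Ui Ue =
     (1/2) *\<^sub>R (euler_flux g B Ui *v n + euler_flux g B Ue *v n
               - max (wave_speed g B n Ui) (wave_speed g B n Ue) *\<^sub>R (Ue - Ui))"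

text \<open>The argument pair is the pressure and the normal velocity delivered by a multi-material
  Riemann solver.\<close>
definition multi_flux :: "real^2 \<Rightarrow> real \<times> real \<Rightarrow> state" where
  "multi_flux n q = (case q of (p, w) \<Rightarrow> vector [0, p * n $ 1, p * n $ 2, p * w])"

section \<open>Materials, moments and the scheme parameters\<close>

text \<open>The two materials occupy the regions where the level set function is nonpositive,
  respectively nonnegative.\<close>
datatype material = Neg | Pos

type_synonym moments = "nat \<Rightarrow> nat \<Rightarrow> real"

text \<open>A subcell (a cut cell or an uncut Cartesian cell) is a region of the plane; a control
  volume (merged cell) is identified by the set of subcells it was merged from.\<close>
type_synonym subcell = "point set"
type_synonym cell = "point set set"

definition cell_average :: "state \<Rightarrow> moments \<Rightarrow> state" where
  "cell_average U M = U /\<^sub>R M 0 0"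

definition rec_moment :: "point set \<Rightarrow> moments" where
  "rec_moment K s q = integral K (\<lambda>x. (x $ 1) ^ s * (x $ 2) ^ q)"

definition poly_sum :: "nat \<Rightarrow> (nat \<Rightarrow> nat \<Rightarrow> state) \<Rightarrow> moments \<Rightarrow> state" where
  "poly_sum N a M = (\<Sum>(s, q) \<in> {(s, q). s + q \<le> N}. M s q *\<^sub>R a s q)"

text \<open>The parts of the scheme that the method leaves open are parameters.  Reconstructions get the
  material and the list of pairs \<open>(U\<^sup>t\<^sup>o\<^sup>t, M\<^sup>e\<^sup>v\<^sup>o)\<close> of the stencil cells, the cell itself first:
  \<open>point_rec\<close> returns point values, \<open>poly_rec\<close> the coefficients \<open>a\<^sub>s\<^sub>,\<^sub>r\<close> used in the
  redistribution.  \<open>riemann mi me n Ui Ue\<close> is the multi-material Riemann solver for an interior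
  state of material \<open>mi\<close> and an exterior state of material \<open>me\<close>.  \<open>ls_solver\<close> is the
  discretization of the level set equation: it gets the time step, the level set functions at the
  stages computed so far and the current cells with their regions, totals and moments, and
  returns the level set function of the next stage.\<close>
record scheme =
  hx :: real
  hy :: real
  gam :: "material \<Rightarrow> real"
  Bpar :: "material \<Rightarrow> real"
  poly_deg :: nat
  point_rec :: "material \<Rightarrow> (state \<times> moments) list \<Rightarrow> point \<Rightarrow> state"
  poly_rec :: "material \<Rightarrow> (state \<times> moments) list \<Rightarrow> nat \<Rightarrow> nat \<Rightarrow> state"
  riemann :: "material \<Rightarrow> material \<Rightarrow> real^2 \<Rightarrow> state \<Rightarrow> state \<Rightarrow> real \<times> real"
  undersized :: "subcell \<Rightarrow> bool"
  ls_solver :: "real \<Rightarrow> (point \<Rightarrow> real) list \<Rightarrow> cell set \<Rightarrow> (cell \<Rightarrow> point set) \<Rightarrow>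
                (cell \<Rightarrow> state) \<Rightarrow> (cell \<Rightarrow> moments) \<Rightarrow> point \<Rightarrow> real"

abbreviation equilibrium :: "scheme \<Rightarrow> real^2 \<Rightarrow> real \<Rightarrow> material \<Rightarrow> state set" where
  "equilibrium S v p m \<equiv> equilibrium_set v p (gam S m) (Bpar S m)"

text \<open>Equilibrium compatibility of a point reconstruction.\<close>
definition equilibrium_compatible ::
    "scheme \<Rightarrow> material \<Rightarrow> ((state \<times> moments) list \<Rightarrow> point \<Rightarrow> state) \<Rightarrow> bool" where
  "equilibrium_compatible S m R \<longleftrightarrow>
     (\<forall>data v p. data \<noteq> [] \<longrightarrow>
        (\<forall>(U, M) \<in> set data. cell_average U M \<in> equilibrium S v p m) \<longrightarrow>
        (\<forall>x. has_velocity_pressure v p (gam S m) (Bpar S m) (R data x)))"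

definition poly_conservative :: "nat \<Rightarrow> ((state \<times> moments) list \<Rightarrow> nat \<Rightarrow> nat \<Rightarrow> state) \<Rightarrow> bool" where
  "poly_conservative N P \<longleftrightarrow>
     (\<forall>U M rest. M 0 0 \<noteq> 0 \<longrightarrow> poly_sum N (P ((U, M) # rest)) M = U)"

definition riemann_consistent :: "scheme \<Rightarrow> bool" where
  "riemann_consistent S \<longleftrightarrow>
     (\<forall>mi me n Ui Ue p w. norm n = 1 \<longrightarrow> density Ui > 0 \<longrightarrow> density Ue > 0 \<longrightarrow>
        pressure (gam S mi) (Bpar S mi) Ui = p \<longrightarrow> pressure (gam S me) (Bpar S me) Ue = p \<longrightarrow>
        velocity Ui \<bullet> n = w \<longrightarrow> velocity Ue \<bullet> n = w \<longrightarrow>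
        riemann S mi me n Ui Ue = (p, w))"

definition GPR_scheme :: "scheme \<Rightarrow> bool" where
  "GPR_scheme S \<longleftrightarrow>
     hx S > 0 \<and> hy S > 0 \<and>
     (\<forall>m. gam S m > 1 \<and> Bpar S m \<ge> 0) \<and>
     (\<forall>m. equilibrium_compatible S m (point_rec S m)) \<and>
     (\<forall>m. equilibrium_compatible S m
        (\<lambda>data x. poly_sum (poly_deg S) (poly_rec S m data) (\<lambda>s q. (x $ 1) ^ s * (x $ 2) ^ q))) \<and>
     (\<forall>m. poly_conservative (poly_deg S) (poly_rec S m)) \<and>
     riemann_consistent S"

section \<open>Polygons and Gauss points\<close>

datatype edge_kind = Cartesian | Interface

text \<open>A directed boundary segment of a control volume, with the control volume on its other
  side.\<close>
datatype edge = Edge (esrc: point) (edst: point) (ekind: edge_kind) (eacross: cell)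

definition segment :: "edge \<Rightarrow> point set" where
  "segment e = closed_segment (esrc e) (edst e)"

definition edge_length :: "edge \<Rightarrow> real" where
  "edge_length e = dist (esrc e) (edst e)"

text \<open>The unit vector pointing to the right of the direction of travel.\<close>
definition edge_normal :: "edge \<Rightarrow> real^2" where
  "edge_normal e =
     (let d = edst e - esrc e in vector [d $ 2, - (d $ 1)] /\<^sub>R edge_length e)"

text \<open>Two-point Gauss rule on a segment.\<close>
definition gauss_points :: "edge \<Rightarrow> point list" where
  "gauss_points e =
     map (\<lambda>t. esrc e + t *\<^sub>R (edst e - esrc e)) [1/2 - 1 / (2 * sqrt 3), 1/2 + 1 / (2 * sqrt 3)]"

definition gauss_weight :: real where
  "gauss_weight = 1/2"

definition closed_loop :: "edge list \<Rightarrow> bool" where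
  "closed_loop l \<longleftrightarrow> l \<noteq> [] \<and> (\<forall>i<length l. edst (l ! i) = esrc (l ! (Suc i mod length l)))"

text \<open>\<open>K\<close> is a polygon (not necessarily simply connected) whose boundary is the given family of
  closed loops, oriented so that the edge normals are the outward normals of \<open>K\<close>.  Finitely many
  points of a segment are excepted from the last condition because a vertex of another segment may
  touch it.\<close>
definition polygon :: "point set \<Rightarrow> edge list list \<Rightarrow> bool" where
  "polygon K ls \<longleftrightarrow>
     compact K \<and> interior K \<noteq> {} \<and>
     (\<forall>l \<in> set ls. closed_loop l) \<and>
     frontier K = (\<Union>e \<in> set (concat ls). segment e) \<and>
     sorted_wrt (\<lambda>e f. finite (segment e \<inter> segment f)) (concat ls) \<and>
     (\<forall>e \<in> set (concat ls).
        finite {x \<in> open_segment (esrc e) (edst e).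
          \<not> (\<forall>\<^sub>F t in at_right 0. x + t *\<^sub>R edge_normal e \<notin> K \<and> x - t *\<^sub>R edge_normal e \<in> K)})"

section \<open>Grid, interface, cut cells and cell merging\<close>

definition cart_cell :: "scheme \<Rightarrow> int \<Rightarrow> int \<Rightarrow> point set" where
  "cart_cell S i j =
     cbox (vector [of_int i * hx S, of_int j * hy S])
          (vector [of_int (i + 1) * hx S, of_int (j + 1) * hy S])"

definition on_grid_line :: "scheme \<Rightarrow> point set \<Rightarrow> bool" where
  "on_grid_line S A \<longleftrightarrow>
     (\<exists>i::int. (\<forall>x\<in>A. x $ 1 = of_int i * hx S) \<or> (\<forall>x\<in>A. x $ 2 = of_int i * hy S))"

definition zero_contour :: "(point \<Rightarrow> real) \<Rightarrow> point set" where
  "zero_contour \<phi> = {x. \<phi> x = 0}"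

text \<open>A (discrete) level set function, with piecewise linear zero contour.\<close>
definition level_set_function :: "scheme \<Rightarrow> (point \<Rightarrow> real) \<Rightarrow> bool" where
  "level_set_function S \<phi> \<longleftrightarrow>
     continuous_on UNIV \<phi> \<and>
     (\<forall>i j. \<exists>E. finite E \<and> zero_contour \<phi> \<inter> cart_cell S i j = (\<Union>(a, b)\<in>E. closed_segment a b))"

definition side :: "(point \<Rightarrow> real) \<Rightarrow> material \<Rightarrow> point set" where
  "side \<phi> m = (case m of Neg \<Rightarrow> {x. \<phi> x \<le> 0} | Pos \<Rightarrow> {x. \<phi> x \<ge> 0})"

text \<open>Meaningful for a single-material region of nonempty interior, see \<open>cut_partition\<close>.\<close>
definition material_of :: "(point \<Rightarrow> real) \<Rightarrow> point set \<Rightarrow> material" where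
  "material_of \<phi> K = (if K \<subseteq> side \<phi> Pos then Pos else Neg)"

text \<open>\<open>P\<close> consists of the polygonal single-material pieces into which the interface cuts the
  Cartesian cells, together with the Cartesian cells that it does not cut.\<close>
definition cut_partition :: "scheme \<Rightarrow> (point \<Rightarrow> real) \<Rightarrow> subcell set \<Rightarrow> bool" where
  "cut_partition S \<phi> P \<longleftrightarrow>
     (\<forall>K\<in>P. (\<exists>ls. polygon K ls) \<and> K \<subseteq> side \<phi> (material_of \<phi> K) \<and> (\<exists>i j. K \<subseteq> cart_cell S i j)) \<and>
     (\<forall>K\<in>P. \<forall>L\<in>P. K \<noteq> L \<longrightarrow> interior K \<inter> interior L = {}) \<and>
     (\<forall>i j. finite {K\<in>P. K \<subseteq> cart_cell S i j} \<and> \<Union>{K\<in>P. K \<subseteq> cart_cell S i j} = cart_cell S i j) \<and>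
     (\<forall>i j. interior (cart_cell S i j) \<inter> zero_contour \<phi> = {} \<longrightarrow> cart_cell S i j \<in> P)"

text \<open>Closed polygons with disjoint interiors are neighbours if they share a segment, i.e.
  infinitely many points.\<close>
definition neighbours :: "(point \<Rightarrow> real) \<Rightarrow> subcell \<Rightarrow> subcell \<Rightarrow> bool" where
  "neighbours \<phi> K L \<longleftrightarrow> K \<noteq> L \<and> infinite (K \<inter> L) \<and> material_of \<phi> K = material_of \<phi> L"

definition undersized_cut :: "scheme \<Rightarrow> subcell \<Rightarrow> bool" where
  "undersized_cut S K \<longleftrightarrow> undersized S K \<and> (\<forall>i j. K \<noteq> cart_cell S i j)"

text \<open>\<open>Q\<close> arises from the subcells \<open>P\<close> by merging undersized cut cells with same-material
  neighbours.\<close>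
definition cell_merging :: "scheme \<Rightarrow> (point \<Rightarrow> real) \<Rightarrow> subcell set \<Rightarrow> cell set \<Rightarrow> bool" where
  "cell_merging S \<phi> P Q \<longleftrightarrow>
     partition_on P Q \<and>
     (\<forall>C\<in>Q. finite C \<and>
        (\<forall>K\<in>C. \<forall>L\<in>C. (K, L) \<in> {(A, B). A \<in> C \<and> B \<in> C \<and> neighbours \<phi> A B \<and>
                                 (undersized_cut S A \<or> undersized_cut S B)}\<^sup>*)) \<and>
     (\<forall>K\<in>P. undersized_cut S K \<and> (\<exists>L\<in>P. neighbours \<phi> K L) \<longrightarrow> {K} \<notin> Q)"

section \<open>Runs of the scheme\<close>

text \<open>The data of a run.  The first index is the time level \<open>n\<close>, the second one the
  Runge-Kutta stage \<open>k\<close>: \<open>k = 0\<close> is \<open>t\<^sup>n\<close>, \<open>k = 1, 2\<close> are the intermediate stages, and \<open>k = 3\<close> is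
  \<open>t\<^sup>n\<^sup>+\<^sup>1\<close> seen from step \<open>n\<close>, before the redistribution.  The control volumes \<open>merged r n\<close> keep
  their identity during step \<open>n\<close>, while their regions and boundaries change with the stage.\<close>
record run =
  dt :: "nat \<Rightarrow> real"
  phi :: "nat \<Rightarrow> nat \<Rightarrow> point \<Rightarrow> real"
  subcells :: "nat \<Rightarrow> subcell set"
  merged :: "nat \<Rightarrow> cell set"
  region :: "nat \<Rightarrow> nat \<Rightarrow> cell \<Rightarrow> point set"
  bdry :: "nat \<Rightarrow> nat \<Rightarrow> cell \<Rightarrow> edge list list"
  stencil :: "nat \<Rightarrow> nat \<Rightarrow> cell \<Rightarrow> cell list"
  Usub :: "nat \<Rightarrow> subcell \<Rightarrow> state"
  Utot :: "nat \<Rightarrow> nat \<Rightarrow> cell \<Rightarrow> state"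
  Mevo :: "nat \<Rightarrow> nat \<Rightarrow> cell \<Rightarrow> moments"

text \<open>The stages that occur in a computation of \<open>N\<close> time steps.\<close>
definition active :: "nat \<Rightarrow> nat \<Rightarrow> nat \<Rightarrow> bool" where
  "active N n k \<longleftrightarrow> n < N \<and> k \<le> 3 \<or> n = N \<and> k = 0"

definition cell_material :: "run \<Rightarrow> nat \<Rightarrow> cell \<Rightarrow> material" where
  "cell_material r n C = material_of (phi r n 0) (\<Union>C)"

definition edges :: "run \<Rightarrow> nat \<Rightarrow> nat \<Rightarrow> cell \<Rightarrow> edge list" where
  "edges r n k C = concat (bdry r n k C)"

definition cartesian_edges :: "run \<Rightarrow> nat \<Rightarrow> nat \<Rightarrow> cell \<Rightarrow> edge list" where
  "cartesian_edges r n k C = filter (\<lambda>e. ekind e = Cartesian) (edges r n k C)"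

definition interface_edges :: "run \<Rightarrow> nat \<Rightarrow> nat \<Rightarrow> cell \<Rightarrow> edge list" where
  "interface_edges r n k C = filter (\<lambda>e. ekind e = Interface) (edges r n k C)"

text \<open>The control volumes tile the plane.  Cartesian edges lie on grid lines, so that they can
  only move tangentially, and separate control volumes of the same material; interface edges lie
  on the current interface and separate the two materials.\<close>
definition valid_mesh :: "scheme \<Rightarrow> run \<Rightarrow> nat \<Rightarrow> nat \<Rightarrow> bool" where
  "valid_mesh S r n k \<longleftrightarrow>
     level_set_function S (phi r n k) \<and>
     (\<Union>C\<in>merged r n. region r n k C) = UNIV \<and>
     (\<forall>C\<in>merged r n. \<forall>D\<in>merged r n. C \<noteq> D \<longrightarrow>
        interior (region r n k C) \<inter> interior (region r n k D) = {}) \<and>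
     (\<forall>C\<in>merged r n.
        polygon (region r n k C) (bdry r n k C) \<and>
        region r n k C \<subseteq> side (phi r n k) (cell_material r n C) \<and>
        (\<forall>e\<in>set (edges r n k C).
           eacross e \<in> merged r n \<and> eacross e \<noteq> C \<and> segment e \<subseteq> region r n k (eacross e) \<and>
           (case ekind e of
              Cartesian \<Rightarrow> on_grid_line S (segment e) \<and> cell_material r n (eacross e) = cell_material r n C
            | Interface \<Rightarrow> segment e \<subseteq> zero_contour (phi r n k) \<and>
                           cell_material r n (eacross e) \<noteq> cell_material r n C)))"

definition valid_stencils :: "run \<Rightarrow> nat \<Rightarrow> nat \<Rightarrow> bool" where
  "valid_stencils r n k \<longleftrightarrow>
     (\<forall>C\<in>merged r n. stencil r n k C \<noteq> [] \<and> hd (stencil r n k C) = C \<and>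
        (\<forall>D\<in>set (stencil r n k C). D \<in> merged r n \<and> cell_material r n D = cell_material r n C))"

definition stencil_data :: "run \<Rightarrow> nat \<Rightarrow> nat \<Rightarrow> cell \<Rightarrow> (state \<times> moments) list" where
  "stencil_data r n k C = map (\<lambda>D. (Utot r n k D, Mevo r n k D)) (stencil r n k C)"

definition rec_value :: "scheme \<Rightarrow> run \<Rightarrow> nat \<Rightarrow> nat \<Rightarrow> cell \<Rightarrow> point \<Rightarrow> state" where
  "rec_value S r n k C x = point_rec S (cell_material r n C) (stencil_data r n k C) x"

text \<open>Pressure and normal velocity at the interface Gauss point \<open>x\<close> on the edge \<open>e\<close> of \<open>C\<close>.\<close>
definition interface_solution ::
    "scheme \<Rightarrow> run \<Rightarrow> nat \<Rightarrow> nat \<Rightarrow> cell \<Rightarrow> edge \<Rightarrow> point \<Rightarrow> real \<times> real" where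
  "interface_solution S r n k C e x =
     riemann S (cell_material r n C) (cell_material r n (eacross e)) (edge_normal e)
       (rec_value S r n k C x) (rec_value S r n k (eacross e) x)"

definition L_moment :: "scheme \<Rightarrow> run \<Rightarrow> nat \<Rightarrow> nat \<Rightarrow> cell \<Rightarrow> moments" where
  "L_moment S r n k C s q =
     (\<Sum>e\<leftarrow>interface_edges r n k C. \<Sum>x\<leftarrow>gauss_points e.
        (x $ 1) ^ s * (x $ 2) ^ q * edge_length e * gauss_weight
        * snd (interface_solution S r n k C e x))"

definition L_state :: "scheme \<Rightarrow> run \<Rightarrow> nat \<Rightarrow> nat \<Rightarrow> cell \<Rightarrow> state" where
  "L_state S r n k C =
     - (\<Sum>e\<leftarrow>cartesian_edges r n k C. \<Sum>x\<leftarrow>gauss_points e.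
          (edge_length e * gauss_weight) *\<^sub>R
          single_flux (gam S (cell_material r n C)) (Bpar S (cell_material r n C)) (edge_normal e)
            (rec_value S r n k C x) (rec_value S r n k (eacross e) x))
     - (\<Sum>e\<leftarrow>interface_edges r n k C. \<Sum>x\<leftarrow>gauss_points e.
          (edge_length e * gauss_weight) *\<^sub>R
          multi_flux (edge_normal e) (interface_solution S r n k C e x))"

text \<open>One step of the third order SSP Runge-Kutta method; \<open>w k\<close> and \<open>L k\<close> are the value and the
  spatial operator at stage \<open>k\<close>.\<close>
definition ssp_rk3 :: "real \<Rightarrow> (nat \<Rightarrow> 'a::real_vector) \<Rightarrow> (nat \<Rightarrow> 'a) \<Rightarrow> bool" where
  "ssp_rk3 \<tau> w L \<longleftrightarrow>
     w 1 = w 0 + \<tau> *\<^sub>R L 0 \<and>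
     w 2 = (3/4) *\<^sub>R w 0 + (1/4) *\<^sub>R (w 1 + \<tau> *\<^sub>R L 1) \<and>
     w 3 = (1/3) *\<^sub>R w 0 + (2/3) *\<^sub>R (w 2 + \<tau> *\<^sub>R L 2)"

text \<open>Merging at time level \<open>n\<close>: totals and moments of a merged cell are summed over its
  subcells, and the evolved moments are reset to the reconstructed ones.\<close>
definition merge_step :: "scheme \<Rightarrow> run \<Rightarrow> nat \<Rightarrow> bool" where
  "merge_step S r n \<longleftrightarrow>
     cell_merging S (phi r n 0) (subcells r n) (merged r n) \<and>
     (\<forall>C\<in>merged r n.
        region r n 0 C = \<Union>C \<and>
        Utot r n 0 C = (\<Sum>K\<in>C. Usub r n K) \<and>
        (\<forall>s q. Mevo r n 0 C s q = (\<Sum>K\<in>C. rec_moment K s q)))"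

definition evolve_step :: "scheme \<Rightarrow> run \<Rightarrow> nat \<Rightarrow> bool" where
  "evolve_step S r n \<longleftrightarrow>
     dt r n > 0 \<and>
     (\<forall>C\<in>merged r n.
        ssp_rk3 (dt r n) (\<lambda>k. Utot r n k C) (\<lambda>k. L_state S r n k C) \<and>
        (\<forall>s q. ssp_rk3 (dt r n) (\<lambda>k. Mevo r n k C s q) (\<lambda>k. L_moment S r n k C s q)))"

text \<open>Repartition at time level \<open>n + 1\<close> and redistribution.  The subcells of a merged cell are the
  new subcells contained in its evolved region.\<close>
definition redistribute_step :: "scheme \<Rightarrow> run \<Rightarrow> nat \<Rightarrow> bool" where
  "redistribute_step S r n \<longleftrightarrow>
     phi r (Suc n) 0 = phi r n 3 \<and>
     (\<forall>K\<in>subcells r (Suc n). \<exists>C\<in>merged r n. K \<subseteq> region r n 3 C) \<and>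
     (\<forall>C\<in>merged r n.
        region r n 3 C = \<Union>{K\<in>subcells r (Suc n). K \<subseteq> region r n 3 C} \<and>
        (\<forall>K\<in>subcells r (Suc n). K \<subseteq> region r n 3 C \<longrightarrow>
           Usub r (Suc n) K =
             poly_sum (poly_deg S) (poly_rec S (cell_material r n C) (stencil_data r n 3 C)) (rec_moment K)))"

text \<open>The run stays within the states for which the Euler equations make sense: all cell averages
  and all values at which a flux is evaluated have positive density.  Nothing is required of
  velocities or pressures.\<close>
definition positive_densities :: "scheme \<Rightarrow> nat \<Rightarrow> run \<Rightarrow> bool" where
  "positive_densities S N r \<longleftrightarrow>
     (\<forall>n\<le>N. \<forall>K\<in>subcells r n. density (cell_average (Usub r n K) (rec_moment K)) > 0) \<and>
     (\<forall>n k. active N n k \<longrightarrow> (\<forall>C\<in>merged r n.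
        density (cell_average (Utot r n k C) (Mevo r n k C)) > 0)) \<and>
     (\<forall>n<N. \<forall>k<3. \<forall>C\<in>merged r n. \<forall>e\<in>set (edges r n k C). \<forall>x\<in>set (gauss_points e).
        density (rec_value S r n k C x) > 0 \<and> density (rec_value S r n k (eacross e) x) > 0)"

text \<open>\<open>r\<close> is a computation of \<open>N\<close> time steps with the scheme, in which the mesh is cut by the
  zero contours of \<open>phi r\<close>, wherever these come from.\<close>
definition GPR_run :: "scheme \<Rightarrow> nat \<Rightarrow> run \<Rightarrow> bool" where
  "GPR_run S N r \<longleftrightarrow>
     (\<forall>n\<le>N. cut_partition S (phi r n 0) (subcells r n) \<and> merge_step S r n) \<and>
     (\<forall>n k. active N n k \<longrightarrow> valid_mesh S r n k \<and> valid_stencils r n k) \<and>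
     (\<forall>n<N. evolve_step S r n \<and> redistribute_step S r n) \<and>
     positive_densities S N r"

text \<open>The interface of the run is the one captured by the level set solver of the scheme.\<close>
definition captured :: "scheme \<Rightarrow> nat \<Rightarrow> run \<Rightarrow> bool" where
  "captured S N r \<longleftrightarrow>
     (\<forall>n<N. \<forall>k<3. phi r n (Suc k) =
        ls_solver S (dt r n) (map (phi r n) [0..<Suc k]) (merged r n) (region r n k)
          (Utot r n k) (Mevo r n k))"

section \<open>Pressure equilibrium preservation and geometric perturbation robustness\<close>

text \<open>The cell averages attached to the point \<open>x\<close> at time level \<open>n\<close>, with the material of the
  cell: those of the subcells and of the merged cells containing \<open>x\<close>, and, for \<open>n > 0\<close>, those of
  the control volumes evolved up to this time, before redistribution.  Several cells can contain
  \<open>x\<close> because cells are closed.\<close>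
definition solution :: "run \<Rightarrow> nat \<Rightarrow> point \<Rightarrow> (material \<times> state) set" where
  "solution r n x =
     {(material_of (phi r n 0) K, cell_average (Usub r n K) (rec_moment K)) | K.
        K \<in> subcells r n \<and> x \<in> K} \<union>
     {(cell_material r n C, cell_average (Utot r n 0 C) (Mevo r n 0 C)) | C.
        C \<in> merged r n \<and> x \<in> region r n 0 C} \<union>
     {(cell_material r m C, cell_average (Utot r m 3 C) (Mevo r m 3 C)) | m C.
        n = Suc m \<and> C \<in> merged r m \<and> x \<in> region r m 3 C}"

definition preserves_equilibrium :: "scheme \<Rightarrow> nat \<Rightarrow> run \<Rightarrow> bool" where
  "preserves_equilibrium S N r \<longleftrightarrow>
     (\<forall>v p. (\<forall>x. \<forall>(m, U) \<in> solution r 0 x. U \<in> equilibrium S v p m) \<longrightarrow>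
        (\<forall>n. 0 < n \<and> n \<le> N \<longrightarrow> (\<forall>x. \<forall>(m, U) \<in> solution r n x. U \<in> equilibrium S v p m)))"

definition pressure_equilibrium_preserving :: "scheme \<Rightarrow> bool" where
  "pressure_equilibrium_preserving S \<longleftrightarrow>
     (\<forall>N r. GPR_run S N r \<and> captured S N r \<longrightarrow> preserves_equilibrium S N r)"

definition hausdorff_distance :: "point set \<Rightarrow> point set \<Rightarrow> ennreal" where
  "hausdorff_distance A B =
     max (SUP a\<in>A. INF b\<in>B. ennreal (dist a b)) (SUP b\<in>B. INF a\<in>A. ennreal (dist a b))"

text \<open>A discrete interface is a history: one zero contour for each time level and stage.\<close>
definition has_interface :: "nat \<Rightarrow> run \<Rightarrow> (nat \<Rightarrow> nat \<Rightarrow> point set) \<Rightarrow> bool" where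
  "has_interface N r \<Gamma> \<longleftrightarrow> (\<forall>n k. active N n k \<longrightarrow> zero_contour (phi r n k) = \<Gamma> n k)"

text \<open>A perturbed interface need not be captured by the level set solver; the scheme is then run on
  the mesh cut by the perturbed interface.  Perturbations are allowed at all times.\<close>
definition geometric_perturbation_robust :: "scheme \<Rightarrow> bool" where
  "geometric_perturbation_robust S \<longleftrightarrow>
     (\<forall>\<Gamma>. (\<forall>N r. GPR_run S N r \<and> captured S N r \<and> has_interface N r \<Gamma> \<longrightarrow>
               preserves_equilibrium S N r) \<longrightarrow>
        (\<exists>\<epsilon>>0. \<forall>\<Gamma>'. (\<forall>n k. hausdorff_distance (\<Gamma> n k) (\<Gamma>' n k) < ennreal \<epsilon>) \<longrightarrow>
           (\<forall>N r. GPR_run S N r \<and> has_interface N r \<Gamma>' \<longrightarrow> preserves_equilibrium S N r)))"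

end

theory Submission
  imports Defs
begin

text \<open>Fix \<open>v\<close> and \<open>p\<close> and let \<open>c = (p + \<gamma> B) / (\<gamma> - 1)\<close> be the internal energy density of the
  equilibrium.  A cell average \<open>U / M\<^sub>0\<^sub>0\<close> of positive density is in equilibrium iff the linear
  map \<open>residual v U = (momentum - density v, energy - density |v|\<^sup>2 / 2)\<close> equals
  \<open>(0, c M\<^sub>0\<^sub>0)\<close>.  This relation is linear in \<open>(U, M\<^sub>0\<^sub>0)\<close>, so merging and the Runge-Kutta
  combinations respect it once the spatial operators satisfy it.  They do because the edges of a
  control volume form closed loops: the sum of \<open>|e| n\<close> over all edges vanishes, so the net energy
  outflow \<open>c v \<bullet> n\<close> through the Cartesian edges is minus the volume change caused by the interface
  edges.  Redistribution respects it because it integrates over the new subcell a polynomial whose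
  residual is the constant \<open>(0, c)\<close>.  Nowhere does it matter how the interface was obtained, so the
  argument applies to every perturbed interface.\<close>

section \<open>Equilibrium as a linear condition\<close>

text \<open>The kinetic energy is formed with the fixed \<open>v\<close> instead of
  \<open>velocity U\<close>, which keeps the map linear in \<open>U\<close>; at velocity
  \<open>v\<close> the second component is the internal energy.\<close>

definition residual :: "real^2 \<Rightarrow> state \<Rightarrow> (real^2) \<times> real" where
  "residual v U = (momentum U - density U *\<^sub>R v, energy U - 1/2 * density U * (norm v)\<^sup>2)"

definition internal_energy :: "real \<Rightarrow> real \<Rightarrow> real \<Rightarrow> real" where
  "internal_energy p g B = (p + g * B) / (g - 1)"

lemma linear_residual: "linear (residual v)"
  by (rule linearI)
     (simp_all add: residual_def momentum_def density_def energy_def vec_eq_iff forall_2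
        algebra_simps)

lemma bounded_linear_residual: "bounded_linear (residual v)"
  using linear_residual by (simp add: linear_conv_bounded_linear)

lemmas residual_simps =
  linear_add[OF linear_residual] linear_diff[OF linear_residual] linear_neg[OF linear_residual]
  linear_scale[OF linear_residual] linear_0[OF linear_residual]

lemma has_velocity_pressure_residual:
  assumes "g > 1"
  shows "has_velocity_pressure v p g B U \<longleftrightarrow> residual v U = (0, internal_energy p g B)"
  using assms by (auto simp: has_velocity_pressure_def residual_def internal_energy_def field_simps)

text \<open>Clearing the denominator \<open>M 0 0\<close> leaves an equation that is jointly linear
  in the total \<open>U\<close> and the volume \<open>M 0 0\<close>.\<close>

lemma cell_average_equilibrium_iff:
  assumes "g > 1"
  shows "cell_average U M \<in> equilibrium_set v p g B \<longleftrightarrow>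
    density (cell_average U M) > 0 \<and> residual v U = (0, internal_energy p g B * M 0 0)"
proof (cases "density (cell_average U M) > 0")
  case True
  \<comment> \<open>Division by zero would yield the zero state, whose density is not
    positive.\<close>
  then have "M 0 0 \<noteq> 0"
    by (auto simp: cell_average_def density_def)
  have "cell_average U M \<in> equilibrium_set v p g B \<longleftrightarrow>
      residual v (cell_average U M) = (0, internal_energy p g B)"
    using True assms
    by (auto simp: equilibrium_set_iff has_velocity_pressure_iff
          simp flip: has_velocity_pressure_residual)
  also have "residual v (cell_average U M) = residual v U /\<^sub>R M 0 0"
    by (simp add: cell_average_def residual_simps)
  also have "\<dots> = (0, internal_energy p g B) \<longleftrightarrow> residual v U = (0, internal_energy p g B * M 0 0)"
    using \<open>M 0 0 \<noteq> 0\<close> by (cases "residual v U") (auto simp: field_simps)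
  finally show ?thesis using True by simp
qed (use assms in \<open>auto simp: equilibrium_set_iff\<close>)

section \<open>Fluxes\<close>

text \<open>At velocity \<open>v\<close> the flux is \<open>U\<close> scaled by
  \<open>v \<bullet> n\<close> plus the vector \<open>(0, p n, p (v \<bullet> n))\<close>. The first
  part contributes \<open>(0, c)\<close> scaled by \<open>v \<bullet> n\<close>, the second
  \<open>(p n, p (v \<bullet> n))\<close>, so the density drops out.\<close>

lemma residual_euler_flux:
  assumes "velocity U = v" "pressure g B U = p" "density U \<noteq> 0" "g > 1"
  shows "residual v (euler_flux g B U *v n) = (p *\<^sub>R n, (internal_energy p g B + p) * (v \<bullet> n))"
proof -
  have E: "energy U = internal_energy p g B + 1/2 * density U * (norm v)\<^sup>2"
    using assms has_velocity_pressure_iff[of U v p g B]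
    by (auto simp: has_velocity_pressure_residual residual_def)
  have "euler_flux g B U *v n =
      vector [density U * (v \<bullet> n), density U * v $ 1 * (v \<bullet> n) + p * n $ 1,
        density U * v $ 2 * (v \<bullet> n) + p * n $ 2, (energy U + p) * (v \<bullet> n)]"
    using assms(1,2)
    by (simp add: euler_flux_def Let_def matrix_vector_mult_def vector_4 sum_2 vec_eq_iff forall_4
        inner_vec_def axis_def algebra_simps)
  then show ?thesis
    by (simp only: E)
      (simp add: residual_def momentum_def density_def[of "vector _"] energy_def[of "vector _"]
        vector_4 vec_eq_iff[of "_ :: real^2"] forall_2 algebra_simps)
qed

text \<open>Both states have the same residual, so the dissipation vanishes for any value of the
  wave speeds, and the two physical fluxes have a common residual.\<close>

lemma residual_single_flux:
  assumes "has_velocity_pressure v p g B Ui" "density Ui > 0"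
    and "has_velocity_pressure v p g B Ue" "density Ue > 0" "g > 1"
  shows "residual v (single_flux g B n Ui Ue) = (p *\<^sub>R n, (internal_energy p g B + p) * (v \<bullet> n))"
proof -
  have "residual v (Ue - Ui) = 0"
    using assms by (simp add: residual_simps has_velocity_pressure_residual)
  then have dissipation: "residual v (a *\<^sub>R (Ue - Ui)) = 0" for a
    by (simp only: linear_scale[OF linear_residual] scaleR_zero_right)
  have "residual v (euler_flux g B Ui *v n) = (p *\<^sub>R n, (internal_energy p g B + p) * (v \<bullet> n))"
    "residual v (euler_flux g B Ue *v n) = (p *\<^sub>R n, (internal_energy p g B + p) * (v \<bullet> n))"
    using assms by (auto intro!: residual_euler_flux simp: has_velocity_pressure_iff)
  then show ?thesis
    \<comment> \<open>The instances make the rewriting stop at the scaled jump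
      \<open>Ue - Ui\<close>, which \<open>dissipation\<close> then removes as a whole.\<close>
    unfolding single_flux_def linear_scale[OF linear_residual, of v "1/2"]
      linear_diff[OF linear_residual, of _ _ "_ *\<^sub>R _"] linear_add[OF linear_residual] dissipation
    by (simp add: vec_eq_iff)
qed

lemma residual_multi_flux: "residual v (multi_flux n (p, w)) = (p *\<^sub>R n, p * w)"
  by (simp add: residual_def multi_flux_def momentum_def density_def energy_def vector_4
      vec_eq_iff forall_2)

section \<open>Closed boundaries\<close>

lemma sum_list_concat_map: "(\<Sum>x\<leftarrow>concat xss. f x) = (\<Sum>xs\<leftarrow>xss. \<Sum>x\<leftarrow>xs. f x)"
  for f :: "'a \<Rightarrow> 'b::comm_monoid_add"
  by (induction xss) auto

text \<open>Around a cycle the end points are the start points shifted by one position, so both have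
  the same sum.\<close>

lemma closed_loop_sum_zero:
  assumes "closed_loop l"
  shows "(\<Sum>e\<leftarrow>l. edst e - esrc e) = 0"
proof -
  let ?n = "length l"
  have n: "0 < ?n" using assms by (simp add: closed_loop_def)
  \<comment> \<open>A surjection of a finite set onto itself is injective; index 0 is hit by
    \<open>?n - 1\<close>, any other \<open>j\<close> by \<open>j - 1\<close>.\<close>
  have bij: "bij_betw (\<lambda>i. Suc i mod ?n) {..<?n} {..<?n}"
  proof -
    have "(\<lambda>i. Suc i mod ?n) ` {..<?n} = {..<?n}"
    proof
      show "{..<?n} \<subseteq> (\<lambda>i. Suc i mod ?n) ` {..<?n}"
      proof
        fix j assume "j \<in> {..<?n}"
        then show "j \<in> (\<lambda>i. Suc i mod ?n) ` {..<?n}"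
          using n by (cases j) (auto intro: image_eqI[of _ _ "?n - 1"] image_eqI[of _ _ "j - 1"])
      qed
    qed (use n in auto)
    then show ?thesis by (simp add: bij_betw_def eq_card_imp_inj_on)
  qed
  have "(\<Sum>i<?n. edst (l ! i)) = (\<Sum>i<?n. esrc (l ! (Suc i mod ?n)))"
    using assms by (intro sum.cong) (auto simp: closed_loop_def)
  also have "\<dots> = (\<Sum>i<?n. esrc (l ! i))"
    by (rule sum.reindex_bij_betw[OF bij])
  finally show ?thesis
    by (simp add: sum_list_sum_nth atLeast0LessThan sum_subtractf)
qed

text \<open>The length cancels the normalization, leaving a linear function of the edge vector; for
  a degenerate edge both sides are zero.\<close>

lemma scaled_edge_normal:
  "edge_length e *\<^sub>R edge_normal e = vector [(edst e - esrc e) $ 2, - ((edst e - esrc e) $ 1)]"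
proof (cases "edge_length e = 0")
  case True
  then show ?thesis by (simp add: edge_length_def vec_eq_iff forall_2)
qed (simp add: edge_normal_def Let_def)

lemma norm_edge_normal:
  assumes "edge_length e \<noteq> 0"
  shows "norm (edge_normal e) = 1"
proof -
  have "norm (vector [d $ 2, - (d $ 1)] :: real^2) = norm d" for d :: "real^2"
    by (simp add: norm_vec_def L2_set_def sum_2 add.commute)
  then show ?thesis
    using assms
    by (simp add: edge_normal_def Let_def edge_length_def dist_norm norm_minus_commute
        del: vector_minus_component)
qed

text \<open>This is the divergence theorem for constant fields: the scaled normals are the edge
  vectors turned clockwise by a right angle, and this rotation commutes with the sum that vanishes
  around each loop.\<close>

lemma closed_boundary:
  assumes "\<forall>l\<in>set ls. closed_loop l"
  shows "(\<Sum>e\<leftarrow>concat ls. edge_length e *\<^sub>R edge_normal e) = 0"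
proof -
  define rot :: "real^2 \<Rightarrow> real^2" where "rot d = vector [d $ 2, - (d $ 1)]" for d
  have rot: "linear rot"
    by (rule linearI) (simp_all add: rot_def vec_eq_iff forall_2)
  have rot_sum: "(\<Sum>x\<leftarrow>xs. rot (f x)) = rot (\<Sum>x\<leftarrow>xs. f x)" for f :: "edge \<Rightarrow> real^2" and xs
    by (induction xs) (simp_all add: linear_add[OF rot] linear_0[OF rot])
  have "(\<Sum>e\<leftarrow>l. edge_length e *\<^sub>R edge_normal e) = 0" if "l \<in> set ls" for l
    using rot_sum[of "\<lambda>e. edst e - esrc e" l] closed_loop_sum_zero[of l] assms that
      linear_0[OF rot]
    unfolding scaled_edge_normal rot_def[symmetric] by simp
  then have "(\<Sum>l\<leftarrow>ls. \<Sum>e\<leftarrow>l. edge_length e *\<^sub>R edge_normal e) = (\<Sum>l\<leftarrow>ls. 0)"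
    by (intro arg_cong[of _ _ sum_list] map_cong) auto
  then show ?thesis by (simp add: sum_list_concat_map)
qed

section \<open>Sums over the two kinds of edges and Gauss quadrature of constants\<close>

lemma sum_list_filter_split:
  fixes f :: "edge \<Rightarrow> 'a::comm_monoid_add"
  shows "(\<Sum>e\<leftarrow>filter (\<lambda>e. ekind e = Cartesian) es. f e) +
    (\<Sum>e\<leftarrow>filter (\<lambda>e. ekind e = Interface) es. f e) = (\<Sum>e\<leftarrow>es. f e)"
proof (induction es)
  case (Cons e es)
  then show ?case by (cases "ekind e") (auto simp: ac_simps)
qed simp

text \<open>The two weights add up to 1. In equilibrium the flux residuals and the normal velocity
  are constant along an edge, so the quadrature enters only in this form.\<close>

lemma gauss_quadrature_const:
  fixes f :: "point \<Rightarrow> 'a::real_vector"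
  assumes "\<And>x. x \<in> set (gauss_points e) \<Longrightarrow> f x = (edge_length e * gauss_weight) *\<^sub>R q"
  shows "(\<Sum>x\<leftarrow>gauss_points e. f x) = edge_length e *\<^sub>R q"
  using assms by (simp add: gauss_points_def gauss_weight_def flip: scaleR_add_left)

section \<open>Redistribution\<close>

lemma integrable_on_compact:
  fixes f :: "'a::euclidean_space \<Rightarrow> 'b::euclidean_space"
  assumes "compact K" "continuous_on UNIV f"
  shows "f integrable_on K"
proof -
  have "set_integrable lborel K f"
    unfolding set_integrable_def
    by (rule borel_integrable_compact) (use assms continuous_on_subset in auto)
  then show ?thesis
    by (rule set_borel_integral_eq_integral)
qed

lemma finite_degree_le: "finite {(s, q). s + q \<le> (N::nat)}"
  by (rule finite_subset[of _ "{..N} \<times> {..N}"]) auto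

lemma poly_sum_rec_moment:
  assumes "compact K"
  shows "((\<lambda>x. poly_sum N a (\<lambda>s q. (x $ 1) ^ s * (x $ 2) ^ q)) has_integral
    poly_sum N a (rec_moment K)) K"
proof -
  have "((\<lambda>x::point. ((x $ 1) ^ s * (x $ 2) ^ q) *\<^sub>R a s q) has_integral rec_moment K s q *\<^sub>R a s q) K"
    for s q
  proof -
    have "(\<lambda>x::point. (x $ 1) ^ s * (x $ 2) ^ q) integrable_on K"
      by (rule integrable_on_compact[OF assms]) (intro continuous_intros)
    then show ?thesis
      unfolding rec_moment_def by (intro has_integral_scaleR_left integrable_integral)
  qed
  then show ?thesis
    unfolding poly_sum_def by (intro has_integral_sum finite_degree_le) auto
qed

text \<open>A bounded linear map commutes with integration, and the residual of the polynomial is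
  constant, so integration multiplies it by the area of \<open>K\<close>. Only moments of the new
  geometry occur, so their discrepancy from the evolved moments does no harm.\<close>

lemma residual_poly_sum:
  assumes K: "compact K" and g: "g > 1"
    and eq: "\<And>x::point. has_velocity_pressure v p g B (poly_sum N a (\<lambda>s q. (x $ 1) ^ s * (x $ 2) ^ q))"
  shows "residual v (poly_sum N a (rec_moment K)) = (0, internal_energy p g B * rec_moment K 0 0)"
proof -
  let ?c = "internal_energy p g B"
  have "((\<lambda>x::point. (0, ?c) :: (real^2) \<times> real) has_integral
      residual v (poly_sum N a (rec_moment K))) K"
    using has_integral_linear[OF poly_sum_rec_moment[OF K, of N a] bounded_linear_residual[of v]] eq g
    by (simp add: o_def has_velocity_pressure_residual)
  moreover have "((\<lambda>x::point. 1) has_integral rec_moment K 0 0) K"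
    using integrable_integral[OF integrable_on_compact[OF K continuous_on_const, of "1::real"]]
    by (simp add: rec_moment_def)
  then have "((\<lambda>x::point. 1 *\<^sub>R (0, ?c) :: (real^2) \<times> real) has_integral
      rec_moment K 0 0 *\<^sub>R (0, ?c)) K"
    by (rule has_integral_scaleR_left)
  then have "((\<lambda>x::point. (0, ?c) :: (real^2) \<times> real) has_integral
      (0, ?c * rec_moment K 0 0)) K"
    by (simp add: mult.commute)
  ultimately show ?thesis
    by (rule has_integral_unique)
qed

section \<open>Materials of cells\<close>

lemma interior_Union_segments:
  fixes E :: "(point \<times> point) set"
  assumes "finite E"
  shows "interior (\<Union>(a, b)\<in>E. closed_segment a b) = {}"
  using assms
proof (induction rule: finite_induct)
  case (insert e E)
  have "interior (closed_segment (fst e) (snd e)) = {}"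
    by (rule interior_closed_segment_ge2) simp
  moreover have "closed (closed_segment (fst e) (snd e))" by simp
  ultimately show ?case
    using insert.IH by (simp add: interior_closed_Un_empty_interior case_prod_beta)
qed simp

text \<open>The two sides overlap in the zero contour, where \<open>material_of\<close> prefers
  \<open>Pos\<close>. A polygon has interior points and so does not fit into the finitely many
  segments that form the contour within a Cartesian cell.\<close>

lemma material_of_cut_cell:
  assumes "cut_partition S \<phi> P" "level_set_function S \<phi>" "K \<in> P" "K \<subseteq> side \<phi> m"
  shows "material_of \<phi> K = m"
proof (cases m)
  case Pos
  then show ?thesis using assms(4) by (simp add: material_of_def)
next
  case Neg
  obtain ls i j where "polygon K ls" "K \<subseteq> cart_cell S i j"
    using assms(1,3) unfolding cut_partition_def by meson
  then have "interior K \<noteq> {}" by (simp add: polygon_def)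
  obtain E where "finite E"
    "zero_contour \<phi> \<inter> cart_cell S i j = (\<Union>(a, b)\<in>E. closed_segment a b)"
    using assms(2) unfolding level_set_function_def by meson
  then have "interior (zero_contour \<phi> \<inter> cart_cell S i j) = {}"
    using interior_Union_segments by metis
  then have "\<not> K \<subseteq> zero_contour \<phi>"
    using \<open>interior K \<noteq> {}\<close> \<open>K \<subseteq> cart_cell S i j\<close> interior_mono[of K "zero_contour \<phi> \<inter> cart_cell S i j"]
    by auto
  then have "\<not> K \<subseteq> side \<phi> Pos"
    using assms(4) Neg by (force simp: side_def zero_contour_def)
  then show ?thesis using Neg by (simp add: material_of_def)
qed

text \<open>Subcells of a merged cell are linked by chains of same-material neighbours, so either
  all of them lie in the \<open>Pos\<close> side or none does.\<close>

lemma cell_material_eq: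
  assumes merging: "cell_merging S (phi r n 0) P (merged r n)"
    and "C \<in> merged r n" "K \<in> C"
  shows "material_of (phi r n 0) K = cell_material r n C"
proof -
  let ?m = "material_of (phi r n 0)"
  have same: "?m L = ?m K" if "L \<in> C" for L
  proof -
    have "(K, L) \<in> {(A, B). A \<in> C \<and> B \<in> C \<and> neighbours (phi r n 0) A B \<and>
        (undersized_cut S A \<or> undersized_cut S B)}\<^sup>*"
      using merging assms(2,3) that unfolding cell_merging_def by blast
    then show ?thesis
      by (induction rule: rtrancl_induct) (auto simp: neighbours_def)
  qed
  have "L \<subseteq> side (phi r n 0) Pos \<longleftrightarrow> K \<subseteq> side (phi r n 0) Pos" if "L \<in> C" for L
    using same[OF that] by (simp add: material_of_def split: if_splits)
  then have "\<Union>C \<subseteq> side (phi r n 0) Pos \<longleftrightarrow> K \<subseteq> side (phi r n 0) Pos"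
    using \<open>K \<in> C\<close> unfolding Sup_le_iff by blast
  then show ?thesis by (simp add: cell_material_def material_of_def)
qed

section \<open>Runs of the scheme\<close>

text \<open>State and volume are advanced by the same linear combinations, with \<open>q\<close> the
  constant residual \<open>(0, c)\<close>. There is one implication per stage because each operator
  is controlled only after its stage is known to be in equilibrium.\<close>

lemma ssp_rk3_proportional:
  assumes f: "linear f" and "ssp_rk3 \<tau> w L" "ssp_rk3 \<tau> m M" "f (w 0) = m 0 *\<^sub>R q"
  shows "f (L 0) = M 0 *\<^sub>R q \<Longrightarrow> f (w 1) = m 1 *\<^sub>R q"
    and "f (w 1) = m 1 *\<^sub>R q \<Longrightarrow> f (L 1) = M 1 *\<^sub>R q \<Longrightarrow> f (w 2) = m 2 *\<^sub>R q"
    and "f (w 2) = m 2 *\<^sub>R q \<Longrightarrow> f (L 2) = M 2 *\<^sub>R q \<Longrightarrow> f (w 3) = m 3 *\<^sub>R q"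
proof -
  have step: "w 1 = w 0 + \<tau> *\<^sub>R L 0"
    "w 2 = (3/4) *\<^sub>R w 0 + (1/4) *\<^sub>R (w 1 + \<tau> *\<^sub>R L 1)"
    "w 3 = (1/3) *\<^sub>R w 0 + (2/3) *\<^sub>R (w 2 + \<tau> *\<^sub>R L 2)"
    using assms(2) unfolding ssp_rk3_def by blast+
  note w = step[THEN arg_cong[of _ _ f], unfolded linear_add[OF f] linear_scale[OF f]]
  have m: "m 1 = m 0 + \<tau> * M 0"
    "m 2 = 3/4 * m 0 + 1/4 * (m 1 + \<tau> * M 1)"
    "m 3 = 1/3 * m 0 + 2/3 * (m 2 + \<tau> * M 2)"
    using assms(3) by (simp_all add: ssp_rk3_def)
  note scale = scaleR_add_left scaleR_add_right scaleR_scaleR distrib_left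
  show "f (w 1) = m 1 *\<^sub>R q" if "f (L 0) = M 0 *\<^sub>R q"
    unfolding w(1) m(1) assms(4) that by (simp only: scale)
  show "f (w 2) = m 2 *\<^sub>R q" if "f (w 1) = m 1 *\<^sub>R q" "f (L 1) = M 1 *\<^sub>R q"
    unfolding w(2) m(2) assms(4) that by (simp only: scale)
  show "f (w 3) = m 3 *\<^sub>R q" if "f (w 2) = m 2 *\<^sub>R q" "f (L 2) = M 2 *\<^sub>R q"
    unfolding w(3) m(3) assms(4) that by (simp only: scale)
qed

section \<open>Equilibrium of control volumes under evolution, merging and redistribution\<close>

context
  fixes S :: scheme and N :: nat and r :: run and v :: "real^2" and p :: real
  assumes scheme: "GPR_scheme S" and run: "GPR_run S N r"
begin

definition equilibrium_stage :: "nat \<Rightarrow> nat \<Rightarrow> bool" where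
  "equilibrium_stage n k \<longleftrightarrow> (\<forall>C\<in>merged r n.
     cell_average (Utot r n k C) (Mevo r n k C) \<in> equilibrium S v p (cell_material r n C))"

definition equilibrium_level :: "nat \<Rightarrow> bool" where
  "equilibrium_level n \<longleftrightarrow> (\<forall>K\<in>subcells r n.
     cell_average (Usub r n K) (rec_moment K) \<in> equilibrium S v p (material_of (phi r n 0) K))"

abbreviation "energy_of m \<equiv> internal_energy p (gam S m) (Bpar S m)"

lemma gam_gt_1: "gam S m > 1"
  using scheme by (simp add: GPR_scheme_def)

text \<open>The run guarantees positive densities at active stages, so only the linear half of the
  criterion remains.\<close>

lemma equilibrium_stage_iff:
  assumes "active N n k"
  shows "equilibrium_stage n k \<longleftrightarrow> (\<forall>C\<in>merged r n.
    residual v (Utot r n k C) = (0, energy_of (cell_material r n C) * Mevo r n k C 0 0))"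
  using run assms
  by (auto simp: equilibrium_stage_def cell_average_equilibrium_iff gam_gt_1 GPR_run_def
      positive_densities_def)

lemma equilibrium_stencil_data:
  assumes "equilibrium_stage n k" "active N n k" "C \<in> merged r n"
  shows "stencil_data r n k C \<noteq> [] \<and> (\<forall>(U, M)\<in>set (stencil_data r n k C).
    cell_average U M \<in> equilibrium S v p (cell_material r n C))"
proof -
  have "valid_stencils r n k" using run assms(2) by (simp add: GPR_run_def)
  then show ?thesis
    using assms(1,3) unfolding valid_stencils_def equilibrium_stage_def stencil_data_def
    by fastforce
qed

lemma rec_value_equilibrium:
  assumes "equilibrium_stage n k" "active N n k" "C \<in> merged r n"
  shows "has_velocity_pressure v p (gam S (cell_material r n C)) (Bpar S (cell_material r n C))
    (rec_value S r n k C x)"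
proof -
  have "equilibrium_compatible S (cell_material r n C) (point_rec S (cell_material r n C))"
    using scheme by (simp add: GPR_scheme_def)
  then show ?thesis
    using equilibrium_stencil_data[OF assms]
    unfolding equilibrium_compatible_def rec_value_def by blast
qed

text \<open>Let \<open>A\<close> and \<open>I\<close> be the sums of scaled normals over the
  Cartesian and the interface edges. The momentum part \<open>- p (A + I)\<close> vanishes, and with
  \<open>A = - I\<close> the energy part
  \<open>- (c + p) (v \<bullet> A) - p (v \<bullet> I)\<close> becomes
  \<open>c (v \<bullet> I)\<close>: the pressure work cancels and \<open>c\<close> times the rate of
  volume change is left.\<close>

lemma residual_L_state:
  assumes stage: "equilibrium_stage n k" and n: "n < N" and k: "k < 3" and C: "C \<in> merged r n"
  shows "residual v (L_state S r n k C) =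
    (0, energy_of (cell_material r n C) * L_moment S r n k C 0 0)"
proof -
  let ?m = "cell_material r n C"
  let ?c = "energy_of ?m"
  let ?Ce = "cartesian_edges r n k C" and ?Ie = "interface_edges r n k C"
  have act: "active N n k" using n k by (simp add: active_def)
  have mesh: "valid_mesh S r n k" using run act by (simp add: GPR_run_def)
  have across: "eacross e \<in> merged r n" if "e \<in> set (edges r n k C)" for e
    using mesh C that by (auto simp: valid_mesh_def)
  have hvp: "has_velocity_pressure v p (gam S ?m) (Bpar S ?m) (rec_value S r n k C x)"
    "e \<in> set (edges r n k C) \<Longrightarrow> has_velocity_pressure v p (gam S (cell_material r n (eacross e)))
       (Bpar S (cell_material r n (eacross e))) (rec_value S r n k (eacross e) x)" for e x
    using rec_value_equilibrium[OF stage act] C across by auto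
  have pos: "density (rec_value S r n k C x) > 0" "density (rec_value S r n k (eacross e) x) > 0"
    if "e \<in> set (edges r n k C)" "x \<in> set (gauss_points e)" for e x
    using run n k C that by (auto simp: GPR_run_def positive_densities_def)
  have single: "residual v (single_flux (gam S ?m) (Bpar S ?m) (edge_normal e)
      (rec_value S r n k C x) (rec_value S r n k (eacross e) x)) =
      (p *\<^sub>R edge_normal e, (?c + p) * (v \<bullet> edge_normal e))"
    if "e \<in> set ?Ce" "x \<in> set (gauss_points e)" for e x
  proof -
    have e: "e \<in> set (edges r n k C)" "ekind e = Cartesian"
      using that by (auto simp: cartesian_edges_def)
    \<comment> \<open>The flux evaluates both states with the parameters of \<open>C\<close>, so the
      exterior cell must have the same material.\<close>
    then have "cell_material r n (eacross e) = ?m"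
      using mesh C by (fastforce simp: valid_mesh_def)
    then show ?thesis
      using hvp(1)[of x] hvp(2)[of e x] pos[of e x] e that gam_gt_1
      by (intro residual_single_flux) auto
  qed
  \<comment> \<open>A degenerate edge has no unit normal, so nothing is known about the Riemann solver there; its
    weight in both operators is zero.\<close>
  have riemann: "interface_solution S r n k C e x = (p, v \<bullet> edge_normal e)"
    if "e \<in> set ?Ie" "x \<in> set (gauss_points e)" "edge_length e \<noteq> 0" for e x
  proof -
    have e: "e \<in> set (edges r n k C)"
      using that by (auto simp: interface_edges_def)
    have "riemann_consistent S" using scheme by (simp add: GPR_scheme_def)
    then show ?thesis
      using hvp(1)[of x] hvp(2)[OF e, of x] pos[OF e that(2)] norm_edge_normal[OF that(3)]
      unfolding riemann_consistent_def interface_solution_def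
      by (auto simp: has_velocity_pressure_iff)
  qed
  have volume: "v \<bullet> (\<Sum>e\<leftarrow>?Ie. edge_length e *\<^sub>R edge_normal e) = L_moment S r n k C 0 0"
  proof -
    have "L_moment S r n k C 0 0 = (\<Sum>e\<leftarrow>?Ie. edge_length e *\<^sub>R (v \<bullet> edge_normal e))"
      unfolding L_moment_def
      apply (intro arg_cong[of _ _ sum_list] map_cong refl gauss_quadrature_const)
      subgoal for e x using riemann[of e x] by (cases "edge_length e = 0") simp_all
      done
    also have "\<dots> = v \<bullet> (\<Sum>e\<leftarrow>?Ie. edge_length e *\<^sub>R edge_normal e)"
    proof -
      have "(\<Sum>e\<leftarrow>es. edge_length e *\<^sub>R (v \<bullet> edge_normal e)) =
          v \<bullet> (\<Sum>e\<leftarrow>es. edge_length e *\<^sub>R edge_normal e)" for es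
        by (induction es) (simp_all add: inner_add_right)
      then show ?thesis .
    qed
    finally show ?thesis by simp
  qed
  have residual_sum: "residual v (\<Sum>x\<leftarrow>xs. f x) = (\<Sum>x\<leftarrow>xs. residual v (f x))"
    for f :: "'z \<Rightarrow> state" and xs
    by (induction xs) (simp_all add: residual_simps)
  have "residual v (L_state S r n k C) =
      - (\<Sum>e\<leftarrow>?Ce. edge_length e *\<^sub>R (p *\<^sub>R edge_normal e, (?c + p) * (v \<bullet> edge_normal e)))
      - (\<Sum>e\<leftarrow>?Ie. edge_length e *\<^sub>R (p *\<^sub>R edge_normal e, p * (v \<bullet> edge_normal e)))"
    unfolding L_state_def linear_diff[OF linear_residual] linear_neg[OF linear_residual]
      residual_sum linear_scale[OF linear_residual]
    apply (intro arg_cong2[of _ _ _ _ minus] arg_cong[of _ _ uminus] arg_cong[of _ _ sum_list]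
        map_cong refl gauss_quadrature_const)
    subgoal for e x using single by simp
    subgoal for e x using riemann[of e x]
      by (cases "edge_length e = 0") (simp_all add: residual_multi_flux zero_prod_def)
    done
  also have "\<dots> = - (p *\<^sub>R (\<Sum>e\<leftarrow>?Ce. edge_length e *\<^sub>R edge_normal e),
        (?c + p) * (v \<bullet> (\<Sum>e\<leftarrow>?Ce. edge_length e *\<^sub>R edge_normal e)))
      - (p *\<^sub>R (\<Sum>e\<leftarrow>?Ie. edge_length e *\<^sub>R edge_normal e),
        p * (v \<bullet> (\<Sum>e\<leftarrow>?Ie. edge_length e *\<^sub>R edge_normal e)))"
  proof -
    \<comment> \<open>Used with \<open>b = ?c + p\<close> on Cartesian edges and
      \<open>b = p\<close> on interface edges, which carry no advected energy.\<close>
    have "(\<Sum>e\<leftarrow>es. edge_length e *\<^sub>R (p *\<^sub>R edge_normal e, b * (v \<bullet> edge_normal e))) =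
        (p *\<^sub>R (\<Sum>e\<leftarrow>es. edge_length e *\<^sub>R edge_normal e),
         b * (v \<bullet> (\<Sum>e\<leftarrow>es. edge_length e *\<^sub>R edge_normal e)))" for b es
      by (induction es) (simp_all add: zero_prod_def algebra_simps)
    then show ?thesis by simp
  qed
  also have "(\<Sum>e\<leftarrow>?Ce. edge_length e *\<^sub>R edge_normal e) =
      - (\<Sum>e\<leftarrow>?Ie. edge_length e *\<^sub>R edge_normal e)"
  proof -
    have "\<forall>l\<in>set (bdry r n k C). closed_loop l"
      using mesh C by (auto simp: valid_mesh_def polygon_def)
    from closed_boundary[OF this] show ?thesis
      using sum_list_filter_split[of "\<lambda>e. edge_length e *\<^sub>R edge_normal e" "edges r n k C"]
      by (simp add: cartesian_edges_def interface_edges_def edges_def eq_neg_iff_add_eq_0)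
  qed
  finally show ?thesis
    by (simp add: volume algebra_simps)
qed

lemma equilibrium_stages:
  assumes "n < N" "equilibrium_stage n 0"
  shows "equilibrium_stage n 1" "equilibrium_stage n 2" "equilibrium_stage n 3"
proof -
  have act: "active N n 0" "active N n 1" "active N n 2" "active N n 3"
    using assms(1) by (auto simp: active_def)
  have rk: "ssp_rk3 (dt r n) (\<lambda>k. Utot r n k C) (\<lambda>k. L_state S r n k C)"
    "ssp_rk3 (dt r n) (\<lambda>k. Mevo r n k C 0 0) (\<lambda>k. L_moment S r n k C 0 0)"
    if "C \<in> merged r n" for C
    using run assms(1) that by (auto simp: GPR_run_def evolve_step_def)
  have L: "residual v (L_state S r n k C) =
      L_moment S r n k C 0 0 *\<^sub>R (0, energy_of (cell_material r n C))"
    if "equilibrium_stage n k" "k < 3" "C \<in> merged r n" for k C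
    using residual_L_state[OF that(1) assms(1) that(2,3)] by (simp add: mult.commute)
  have stage: "equilibrium_stage n k \<longleftrightarrow> (\<forall>C\<in>merged r n.
      residual v (Utot r n k C) = Mevo r n k C 0 0 *\<^sub>R (0, energy_of (cell_material r n C)))"
    if "active N n k" for k
    using equilibrium_stage_iff[OF that] by (simp add: mult.commute)
  note base = assms(2)[unfolded stage[OF act(1)], rule_format]
  note rk_step = ssp_rk3_proportional[OF linear_residual rk base]
  show 1: "equilibrium_stage n 1"
    unfolding stage[OF act(2)]
    by (intro ballI rk_step(1) L[OF assms(2)]) auto
  show 2: "equilibrium_stage n 2"
    unfolding stage[OF act(3)]
    by (intro ballI rk_step(2) L[OF 1] 1[unfolded stage[OF act(2)], rule_format]) auto
  show "equilibrium_stage n 3"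
    unfolding stage[OF act(4)]
    by (intro ballI rk_step(3) L[OF 2] 2[unfolded stage[OF act(3)], rule_format]) auto
qed

text \<open>Totals and moments are summed over the same subcells, whose common material gives a
  common factor \<open>?c\<close>.\<close>

lemma equilibrium_merge:
  assumes "n \<le> N" "equilibrium_level n"
  shows "equilibrium_stage n 0"
proof -
  have act: "active N n 0" using assms(1) by (auto simp: active_def)
  have merge: "merge_step S r n" using run assms(1) by (auto simp: GPR_run_def)
  then have merging: "cell_merging S (phi r n 0) (subcells r n) (merged r n)"
    by (simp add: merge_step_def)
  show ?thesis
    unfolding equilibrium_stage_iff[OF act]
  proof
    fix C assume C: "C \<in> merged r n"
    let ?c = "energy_of (cell_material r n C)"
    have "K \<in> subcells r n" if "K \<in> C" for K
      using merging C that by (auto simp: cell_merging_def partition_on_def)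
    then have "residual v (Usub r n K) = (0, ?c * rec_moment K 0 0)" if "K \<in> C" for K
      using assms(2) that cell_material_eq[OF merging C that]
      by (auto simp: equilibrium_level_def cell_average_equilibrium_iff gam_gt_1)
    then have "residual v (\<Sum>K\<in>C. Usub r n K) = (\<Sum>K\<in>C. (0, ?c * rec_moment K 0 0))"
      by (simp add: linear_sum[OF linear_residual])
    also have "\<dots> = (0, ?c * (\<Sum>K\<in>C. rec_moment K 0 0))"
      by (simp add: sum_prod sum_distrib_left)
    finally show "residual v (Utot r n 0 C) = (0, ?c * Mevo r n 0 C 0 0)"
      using merge C by (simp add: merge_step_def)
  qed
qed

text \<open>A new subcell lies in an evolved control volume and inherits its material, so the
  equilibrium polynomial of that volume is integrated with the right parameters.\<close>

lemma equilibrium_redistribute: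
  assumes "n < N" "equilibrium_stage n 3"
  shows "equilibrium_level (Suc n)"
  unfolding equilibrium_level_def
proof
  fix K assume K: "K \<in> subcells r (Suc n)"
  have act: "active N n 3" using assms(1) by (auto simp: active_def)
  have redist: "redistribute_step S r n" and mesh: "valid_mesh S r n 3"
    and cut: "cut_partition S (phi r (Suc n) 0) (subcells r (Suc n))"
    using run assms(1) act by (auto simp: GPR_run_def)
  obtain C where C: "C \<in> merged r n" "K \<subseteq> region r n 3 C"
    using redist K by (auto simp: redistribute_step_def)
  let ?m = "cell_material r n C"
  have phi: "phi r (Suc n) 0 = phi r n 3" using redist by (simp add: redistribute_step_def)
  have "K \<subseteq> side (phi r n 3) ?m"
    using mesh C unfolding valid_mesh_def by (meson order_trans)
  then have m: "material_of (phi r (Suc n) 0) K = ?m"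
    using material_of_cut_cell[OF cut _ K, of ?m] mesh phi by (simp add: valid_mesh_def)
  have "compact K" using cut K by (auto simp: cut_partition_def polygon_def)
  moreover have "has_velocity_pressure v p (gam S ?m) (Bpar S ?m)
      (poly_sum (poly_deg S) (poly_rec S ?m (stencil_data r n 3 C)) (\<lambda>s q. (x $ 1) ^ s * (x $ 2) ^ q))"
    for x :: point
  proof -
    have "equilibrium_compatible S ?m
        (\<lambda>data x. poly_sum (poly_deg S) (poly_rec S ?m data) (\<lambda>s q. (x $ 1) ^ s * (x $ 2) ^ q))"
      using scheme by (simp add: GPR_scheme_def)
    then show ?thesis
      using equilibrium_stencil_data[OF assms(2) act C(1)]
      unfolding equilibrium_compatible_def by blast
  qed
  ultimately have "residual v (poly_sum (poly_deg S) (poly_rec S ?m (stencil_data r n 3 C))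
      (rec_moment K)) = (0, energy_of ?m * rec_moment K 0 0)"
    by (intro residual_poly_sum gam_gt_1)
  moreover have "Usub r (Suc n) K =
      poly_sum (poly_deg S) (poly_rec S ?m (stencil_data r n 3 C)) (rec_moment K)"
    using redist C K unfolding redistribute_step_def by blast
  ultimately have "residual v (Usub r (Suc n) K) = (0, energy_of ?m * rec_moment K 0 0)"
    by simp
  moreover have "density (cell_average (Usub r (Suc n) K) (rec_moment K)) > 0"
    using run assms(1) K by (auto simp: GPR_run_def positive_densities_def)
  ultimately show "cell_average (Usub r (Suc n) K) (rec_moment K) \<in>
      equilibrium S v p (material_of (phi r (Suc n) 0) K)"
    using m by (simp add: cell_average_equilibrium_iff gam_gt_1)
qed

section \<open>Induction over the time levels and the pointwise solution\<close>

lemma equilibrium_all_levels: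
  assumes "equilibrium_level 0" "n \<le> N"
  shows "equilibrium_level n"
  using assms(2)
proof (induction n)
  case 0
  show ?case by (rule assms(1))
next
  case (Suc n)
  then have "n < N" "equilibrium_level n" by auto
  then have "equilibrium_stage n 0" by (intro equilibrium_merge) auto
  with \<open>n < N\<close> show ?case by (intro equilibrium_redistribute equilibrium_stages(3))
qed

lemma solution_equilibrium:
  assumes init: "\<forall>x. \<forall>(m, U)\<in>solution r 0 x. U \<in> equilibrium S v p m"
    and "n \<le> N" "(m, U) \<in> solution r n x"
  shows "U \<in> equilibrium S v p m"
proof -
  have "equilibrium_level 0"
    unfolding equilibrium_level_def
  proof
    fix K assume K: "K \<in> subcells r 0"
    have "cut_partition S (phi r 0 0) (subcells r 0)" using run by (simp add: GPR_run_def)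
    then have "interior K \<noteq> {}" using K by (auto simp: cut_partition_def polygon_def)
    \<comment> \<open>The initial hypothesis speaks of points; a point of the subcell transfers it
      to the average.\<close>
    then obtain y where "y \<in> K" using interior_subset by fastforce
    then have "(material_of (phi r 0 0) K, cell_average (Usub r 0 K) (rec_moment K)) \<in> solution r 0 y"
      using K by (auto simp: solution_def)
    then show "cell_average (Usub r 0 K) (rec_moment K) \<in> equilibrium S v p (material_of (phi r 0 0) K)"
      using init by blast
  qed
  then have levels: "equilibrium_level i" if "i \<le> N" for i
    using that by (rule equilibrium_all_levels)
  have stages: "equilibrium_stage i 0" if "i \<le> N" for i
    using that levels[OF that] by (rule equilibrium_merge)
  have final_stages: "equilibrium_stage i 3" if "i < N" for i
    using that stages by (intro equilibrium_stages(3)) auto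
  consider (sub) K where "K \<in> subcells r n" "m = material_of (phi r n 0) K"
      "U = cell_average (Usub r n K) (rec_moment K)"
    | (merged) C where "C \<in> merged r n" "m = cell_material r n C"
      "U = cell_average (Utot r n 0 C) (Mevo r n 0 C)"
    | (evolved) i C where "n = Suc i" "C \<in> merged r i" "m = cell_material r i C"
      "U = cell_average (Utot r i 3 C) (Mevo r i 3 C)"
    using assms(3) unfolding solution_def by blast
  then show ?thesis
  proof cases
    case sub
    then show ?thesis
      using levels[OF assms(2)] unfolding equilibrium_level_def by blast
  next
    case merged
    then show ?thesis
      using stages[OF assms(2)] unfolding equilibrium_stage_def by blast
  next
    case evolved
    then show ?thesis
      using final_stages[of i] assms(2) unfolding equilibrium_stage_def by auto
  qed
qed

end

text \<open>The interface history of the run is arbitrary, so captured and perturbed interfaces are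
  covered at once.\<close>

lemma GPR_run_preserves_equilibrium:
  assumes "GPR_scheme S" "GPR_run S N r"
  shows "preserves_equilibrium S N r"
  unfolding preserves_equilibrium_def
  using solution_equilibrium[OF assms] by blast

theorem theorem3p9:
  fixes S :: scheme
  assumes "GPR_scheme S"
  shows "pressure_equilibrium_preserving S \<and> geometric_perturbation_robust S"
  unfolding pressure_equilibrium_preserving_def geometric_perturbation_robust_def
  \<comment> \<open>\<open>zero_less_one\<close> supplies the radius \<open>\<epsilon> = 1\<close>;
    any positive value would do.\<close>
  using GPR_run_preserves_equilibrium[OF assms] zero_less_one by blast

end
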